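(* There exists a convex simple closed smooth curve $\gamma$ in $\mathbb{D}^*$, homologous in $\mathbb{D}^*$ to the circle $C_r=\{|z|=r\}$ ($0<r<1$), such that (i) $\displaystyle\oint_\gamma \kappa_g\,d(\mathrm{length})>2\pi$; (ii) $ds^*$ has no negatively curved completion across $\gamma$. Moreover, such a curve can be taken arbitrarily close to the horocycle of length $2\pi$, i.e. to $C_{1/e}$: for every $\delta>0$ there is such a $\gamma$ contained in $\{z: \big||z|-1/e\big|<\delta\}$.
   Context: $\mathbb{D}=\{z\in\mathbb{C}: |z|<1\}$ and $\mathbb{D}^*=\{z\in\mathbb{C}: 0<|z|<1\}$. The metric $ds^*=-\frac{1}{|z|\log|z|}\,|dz|$ is the complete hyperbolic (curvature $-1$) metric on $\mathbb{D}^*$ conformally equivalent to the Euclidean metric. The circles $C_r=\{|z|=r\}$ are horocycles, of length $-2\pi/\log r$. For a simple closed curve $\gamma$ around $0$ in $\mathbb{D}^*$, $\kappa_g$ is the geodesic curvature of $\gamma$ and $d(\mathrm{length})$ its length element, both with respect to $ds^*$; the sign of $\kappa_g$ is taken with respect to the normal pointing into the component of $\mathbb{D}^*\setminus\gamma$ adjacent to $0$ (so circles centered at $0$ have $\kappa_g=1$). The curve $\gamma$ is convex if $\kappa_g\ge 0$ along $\gamma$. Let $R\subset\mathbb{D}$ be the bounded region enclosed by $\gamma$ (it contains $0$). A negatively curved completion of $ds^*$ across $\gamma=\partial R$ is a Riemannian metric $ds$ on $\mathbb{D}$ such that: $ds$ is conformally equivalent to $ds^*$, i.e. $ds=e^{u}|dz|$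 with $u$ real of class $C^2$ on $\mathbb{D}$; $ds=ds^*$ on $\mathbb{D}\setminus R$; and its Gaussian curvature satisfies $\kappa(ds)<0$ on $\mathbb{D}$. *)

theory Defs
  imports "HOL-Complex_Analysis.Complex_Analysis" "HOL-Homology.Homology"
begin

section \<open>The punctured disk and smooth closed curves\<close>

definition punctured_disk :: "complex set" where
  "punctured_disk = {z. 0 < norm z \<and> norm z < 1}"

text \<open>Velocity of a curve.  Closed curves are 1-periodic functions on the real line, so that
  smoothness at the base point is the usual two-sided notion.\<close>

definition velocity :: "(real \<Rightarrow> complex) \<Rightarrow> real \<Rightarrow> complex" where
  "velocity \<gamma> = (\<lambda>t. vector_derivative \<gamma> (at t))"

definition smooth_curve :: "(real \<Rightarrow> complex) \<Rightarrow> bool" where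
  "smooth_curve \<gamma> \<longleftrightarrow> (\<forall>k t. (velocity ^^ k) \<gamma> differentiable (at t))"

definition smooth_simple_closed_curve :: "(real \<Rightarrow> complex) \<Rightarrow> bool" where
  "smooth_simple_closed_curve \<gamma> \<longleftrightarrow>
     smooth_curve \<gamma> \<and> (\<forall>t. velocity \<gamma> t \<noteq> 0) \<and> (\<forall>t. \<gamma> (t + 1) = \<gamma> t) \<and> simple_path \<gamma>"

text \<open>A path on the unit interval as a singular 1-simplex: the points of the standard 1-simplex are
  the \<open>x\<close> with \<open>x 0 + x 1 = 1\<close>, so \<open>x 1\<close> runs from 0 to 1.\<close>

definition path_simplex :: "(real \<Rightarrow> 'a) \<Rightarrow> (nat \<Rightarrow> real) \<Rightarrow> 'a" where
  "path_simplex p = restrict (\<lambda>x. p (x 1)) (standard_simplex 1)"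

definition homologous_loops ::
  "'a::topological_space set \<Rightarrow> (real \<Rightarrow> 'a) \<Rightarrow> (real \<Rightarrow> 'a) \<Rightarrow> bool" where
  "homologous_loops S p q \<longleftrightarrow>
     homologous_rel 1 (top_of_set S) {} (frag_of (path_simplex p)) (frag_of (path_simplex q))"

section \<open>Conformal metrics\<close>

text \<open>A conformal metric \<open>\<rho> |dz|\<close> is given by its density \<open>\<rho>\<close>, a positive real function.
  As a Riemannian metric it is \<open>g = \<rho>\<^sup>2 (dx\<^sup>2 + dy\<^sup>2)\<close>.\<close>

definition dir_deriv :: "complex \<Rightarrow> (complex \<Rightarrow> real) \<Rightarrow> complex \<Rightarrow> real" where
  "dir_deriv v f z = frechet_derivative f (at z) v"

definition gradient :: "(complex \<Rightarrow> real) \<Rightarrow> complex \<Rightarrow> complex" where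
  "gradient f z = Complex (dir_deriv 1 f z) (dir_deriv \<i> f z)"

definition laplacian :: "(complex \<Rightarrow> real) \<Rightarrow> complex \<Rightarrow> real" where
  "laplacian f z = dir_deriv 1 (dir_deriv 1 f) z + dir_deriv \<i> (dir_deriv \<i> f) z"

text \<open>Class \<open>C\<^sup>2\<close>, intended for open \<open>S\<close>.\<close>

definition C2_on :: "complex set \<Rightarrow> (complex \<Rightarrow> real) \<Rightarrow> bool" where
  "C2_on S f \<longleftrightarrow>
     (\<forall>z\<in>S. f differentiable (at z)) \<and>
     (\<forall>v. \<forall>z\<in>S. dir_deriv v f differentiable (at z)) \<and>
     (\<forall>v w. continuous_on S (dir_deriv w (dir_deriv v f)))"

definition gaussian_curvature :: "(complex \<Rightarrow> real) \<Rightarrow> complex \<Rightarrow> real" where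
  "gaussian_curvature \<rho> z = - laplacian (\<lambda>w. ln (\<rho> w)) z / (\<rho> z)\<^sup>2"

definition metric_inner :: "(complex \<Rightarrow> real) \<Rightarrow> complex \<Rightarrow> complex \<Rightarrow> complex \<Rightarrow> real" where
  "metric_inner \<rho> z v w = (\<rho> z)\<^sup>2 * (v \<bullet> w)"

definition metric_norm :: "(complex \<Rightarrow> real) \<Rightarrow> complex \<Rightarrow> complex \<Rightarrow> real" where
  "metric_norm \<rho> z v = sqrt (metric_inner \<rho> z v v)"

text \<open>The Christoffel symbols of \<open>\<rho>\<^sup>2 (dx\<^sup>2 + dy\<^sup>2)\<close>, with \<open>\<phi> = ln \<rho>\<close>, are
  \<open>\<Gamma>\<^sup>k\<^sub>i\<^sub>j = \<delta>\<^sub>i\<^sub>k \<partial>\<^sub>j\<phi> + \<delta>\<^sub>j\<^sub>k \<partial>\<^sub>i\<phi> - \<delta>\<^sub>i\<^sub>j \<partial>\<^sub>k\<phi>\<close>; here they are contracted with two vectors.\<close>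

definition christoffel ::
  "(complex \<Rightarrow> real) \<Rightarrow> complex \<Rightarrow> complex \<Rightarrow> complex \<Rightarrow> complex" where
  "christoffel \<rho> z v w =
     (let d = gradient (\<lambda>x. ln (\<rho> x)) z
      in (d \<bullet> w) *\<^sub>R v + (d \<bullet> v) *\<^sub>R w - (v \<bullet> w) *\<^sub>R d)"

text \<open>Covariant derivative of the velocity along the curve, for the Levi-Civita connection.\<close>

definition covariant_acceleration ::
  "(complex \<Rightarrow> real) \<Rightarrow> (real \<Rightarrow> complex) \<Rightarrow> real \<Rightarrow> complex" where
  "covariant_acceleration \<rho> \<gamma> t =
     velocity (velocity \<gamma>) t + christoffel \<rho> (\<gamma> t) (velocity \<gamma> t) (velocity \<gamma> t)"

text \<open>The Euclidean unit normal of a simple closed curve pointing into the enclosed bounded region: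
  whichever of the two unit normals does so.\<close>

definition inner_normal :: "(real \<Rightarrow> complex) \<Rightarrow> real \<Rightarrow> complex" where
  "inner_normal \<gamma> t =
     (let n = \<i> * sgn (velocity \<gamma> t)
      in if \<forall>\<^sub>F e in at_right 0. \<gamma> t + e *\<^sub>R n \<in> inside (path_image \<gamma>) then n else - n)"

text \<open>\<open>g(D\<^sub>t\<gamma>', N) / g(\<gamma>', \<gamma>')\<close> with \<open>N\<close> the inner normal that is unit for \<open>g\<close>.  For a curve in the
  punctured disk around 0, the component of the complement adjacent to 0 is the enclosed
  region minus 0, so this \<open>N\<close> points into that component.\<close>

definition geodesic_curvature ::
  "(complex \<Rightarrow> real) \<Rightarrow> (real \<Rightarrow> complex) \<Rightarrow> real \<Rightarrow> real" where
  "geodesic_curvature \<rho> \<gamma> t =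
     metric_inner \<rho> (\<gamma> t) (covariant_acceleration \<rho> \<gamma> t) (inner_normal \<gamma> t /\<^sub>R \<rho> (\<gamma> t))
     / metric_inner \<rho> (\<gamma> t) (velocity \<gamma> t) (velocity \<gamma> t)"

definition total_geodesic_curvature :: "(complex \<Rightarrow> real) \<Rightarrow> (real \<Rightarrow> complex) \<Rightarrow> real" where
  "total_geodesic_curvature \<rho> \<gamma> =
     integral {0..1} (\<lambda>t. geodesic_curvature \<rho> \<gamma> t * metric_norm \<rho> (\<gamma> t) (velocity \<gamma> t))"

definition convex_curve :: "(complex \<Rightarrow> real) \<Rightarrow> (real \<Rightarrow> complex) \<Rightarrow> bool" where
  "convex_curve \<rho> \<gamma> \<longleftrightarrow> (\<forall>t. geodesic_curvature \<rho> \<gamma> t \<ge> 0)"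

section \<open>The hyperbolic metric and its completions\<close>

definition hyp_density :: "complex \<Rightarrow> real" where
  "hyp_density z = - 1 / (norm z * ln (norm z))"

text \<open>The metric \<open>exp u |dz|\<close> is a negatively curved completion of the hyperbolic metric across \<open>\<gamma>\<close>.\<close>

definition negatively_curved_completion :: "(real \<Rightarrow> complex) \<Rightarrow> (complex \<Rightarrow> real) \<Rightarrow> bool" where
  "negatively_curved_completion \<gamma> u \<longleftrightarrow>
     C2_on (ball 0 1) u \<and>
     (\<forall>z \<in> ball 0 1 - inside (path_image \<gamma>). exp (u z) = hyp_density z) \<and>
     (\<forall>z \<in> ball 0 1. gaussian_curvature (\<lambda>w. exp (u w)) z < 0)"

end

theory Submission
  imports Defs
begin

text \<open>
  Write \<open>\<phi> = ln hyp_density\<close>, a radial function with a strict minimum on the circle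
  \<open>norm z = 1 / e\<close>.  A negatively curved completion across a curve is a strictly
  subharmonic function \<open>u\<close> that agrees with \<open>\<phi>\<close> outside the curve.  Integrating
  the Laplacian of \<open>u\<close> over the enclosed region gives the necessary condition that the total
  geodesic curvature exceeds \<open>2 * pi\<close>, which is one inequality between averages.  The maximum
  principle gives necessary conditions at individual boundary points, and these can fail
  although the average is large enough.

  The curves are Euclidean circles with centre \<open>c > 0\<close> slightly off the origin and
  radius \<open>s\<close> slightly above \<open>1 / e\<close>.  The total curvature exceeds \<open>2 * pi\<close> as soon
  as \<open>s\<^sup>2 - c\<^sup>2 > exp (- 2)\<close>
  (\<open>total_geodesic_curvature_circlepath_gt\<close>).  The leftmost point \<open>p = c - s\<close>, however,
  still lies inside the horocycle, where \<open>\<phi>\<close> increases towards 0.  Moving from \<open>p\<close> into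
  the enclosed disk, a completion has to start growing at a rate of the order of \<open>c\<close>.  But along
  the circle \<open>\<phi>\<close> differs from its minimum only to second order, and since \<open>(norm z)\<^sup>2\<close>
  restricted to a circle is an affine function of \<open>z\<close>, \<open>\<phi>\<close> is bounded there by an
  affine function that agrees with it at \<open>p\<close> and has slope of order \<open>c\<^sup>2\<close>.  By the
  maximum principle (\<open>subharmonic_le_affine\<close>) this bound persists inside and contradicts the
  growth (\<open>no_negatively_curved_completion_circlepath\<close>).

  Convexity holds because the circle is close to the horocycle, whose geodesic curvature is 1, and
  the homology class is found by sliding the circle to a concentric one.
\<close>

section \<open>Circles as smooth simple closed curves\<close>

lemma circlepath_cis: "circlepath z r t = z + of_real r * cis (2 * pi * t)"
  by (simp add: circlepath cis_conv_exp mult_ac)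

lemma has_vector_derivative_affine_cis:
  "((\<lambda>t. a + b * cis (2 * pi * t)) has_vector_derivative (2 * pi * \<i> * b) * cis (2 * pi * t)) (at t)"
proof -
  have "((\<lambda>t. a + b * circlepath 0 1 t) has_vector_derivative
          0 + b * (2 * pi * \<i> * 1 * exp (2 * of_real pi * \<i> * t))) (at t)"
    by (intro has_vector_derivative_add has_vector_derivative_const
        has_vector_derivative_mult_right has_vector_derivative_circlepath[THEN has_vector_derivative_eq_rhs]) simp
  then show ?thesis
    by (simp add: circlepath_cis[abs_def] cis_conv_exp mult_ac)
qed

lemma velocity_affine_cis:
  "velocity (\<lambda>t. a + b * cis (2 * pi * t)) = (\<lambda>t. 0 + (2 * pi * \<i> * b) * cis (2 * pi * t))"
  unfolding velocity_def
  by (intro ext) (simp add: vector_derivative_at[OF has_vector_derivative_affine_cis])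

lemma differentiable_affine_cis: "(\<lambda>t. a + b * cis (2 * pi * t)) differentiable (at t)"
  by (rule differentiableI_vector[OF has_vector_derivative_affine_cis])

lemma velocity_circlepath:
  "velocity (circlepath z r) = (\<lambda>t. 0 + (2 * pi * \<i> * r) * cis (2 * pi * t))"
proof -
  have "circlepath z r = (\<lambda>t. z + of_real r * cis (2 * pi * t))"
    by (simp add: circlepath_cis fun_eq_iff)
  then show ?thesis
    using velocity_affine_cis[of z "of_real r"] by simp
qed

lemma velocity_velocity_circlepath:
  "velocity (velocity (circlepath z r)) t = - of_real (4 * pi\<^sup>2 * r) * cis (2 * pi * t)"
proof -
  have "(2 * pi * \<i>) * (2 * pi * \<i> * r) = - of_real (4 * pi\<^sup>2 * r)"
    by (simp add: complex_eq_iff power2_eq_square)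
  then show ?thesis
    unfolding velocity_circlepath velocity_affine_cis by (simp only: add_0_left)
qed

lemma smooth_simple_closed_curve_circlepath:
  assumes "r \<noteq> 0"
  shows "smooth_simple_closed_curve (circlepath z r)"
proof -
  (* All iterated velocities stay in the two-parameter family a + b cis (2 pi t), each
     member of which is differentiable. *)
  have iter: "\<exists>a b. (velocity ^^ k) (circlepath z r) = (\<lambda>t. a + b * cis (2 * pi * t))" for k
  proof (induction k)
    case 0
    have "(velocity ^^ 0) (circlepath z r) = (\<lambda>t. z + of_real r * cis (2 * pi * t))"
      by (simp add: circlepath_cis fun_eq_iff)
    then show ?case by blast
  next
    case (Suc k)
    then obtain a b where "(velocity ^^ k) (circlepath z r) = (\<lambda>t. a + b * cis (2 * pi * t))"
      by blast
    then have "(velocity ^^ Suc k) (circlepath z r) = velocity (\<lambda>t. a + b * cis (2 * pi * t))"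
      by simp
    also note velocity_affine_cis
    finally show ?case by blast
  qed
  have "(velocity ^^ k) (circlepath z r) differentiable (at t)" for k t
  proof -
    obtain a b where "(velocity ^^ k) (circlepath z r) = (\<lambda>t. a + b * cis (2 * pi * t))"
      using iter by blast
    then show ?thesis
      by (simp only: differentiable_affine_cis)
  qed
  then have "smooth_curve (circlepath z r)"
    by (simp add: smooth_curve_def)
  moreover have "velocity (circlepath z r) t \<noteq> 0" for t
    using assms by (simp add: velocity_circlepath)
  moreover have "circlepath z r (t + 1) = circlepath z r t" for t
  proof -
    have "cis (2 * pi * (t + 1)) = cis (2 * pi * t) * cis (2 * pi)"
      by (simp only: cis_mult) (simp add: distrib_left)
    then show ?thesis
      by (simp add: circlepath_cis)
  qed
  ultimately show ?thesis
    using assms by (simp add: smooth_simple_closed_curve_def simple_path_circlepath)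
qed

lemma inside_sphere: "0 < r \<Longrightarrow> inside (sphere z r) = ball z (r::real)"
  for z :: complex
  using inside_frontier_eq_interior[of "cball z r"] by simp

lemma inner_normal_circlepath:
  assumes "0 < r"
  shows "inner_normal (circlepath z r) t = - cis (2 * pi * t)"
proof -
  define w where "w = cis (2 * pi * t)"
  have sgn: "\<i> * sgn (velocity (circlepath z r) t) = - w"
    using assms by (simp add: velocity_circlepath w_def sgn_div_norm norm_mult
        scaleR_conv_of_real field_simps)
  have "\<forall>\<^sub>F e in at_right 0. circlepath z r t + e *\<^sub>R (- w) \<in> ball z r"
    unfolding eventually_at_right_field
  proof (intro exI conjI allI impI)
    show "0 < r" by fact
    fix e :: real assume e: "0 < e" "e < r"
    have "circlepath z r t + e *\<^sub>R (- w) = z + of_real (r - e) * w"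
      by (simp add: circlepath_cis w_def scaleR_conv_of_real algebra_simps)
    then have "dist z (circlepath z r t + e *\<^sub>R (- w)) = r - e"
      using e by (simp add: dist_norm norm_mult w_def del: of_real_diff)
    then show "circlepath z r t + e *\<^sub>R (- w) \<in> ball z r"
      using e by simp
  qed
  then show ?thesis
    using assms unfolding inner_normal_def Let_def sgn by (simp add: inside_sphere w_def)
qed

section \<open>The homology class of a circle\<close>

lemma unit_circle_relcycle:
  "singular_relcycle 1 (top_of_set (sphere 0 1)) {} (frag_of (path_simplex (circlepath (0::complex) 1)))"
proof -
  let ?p = "circlepath (0::complex) 1"
  have "continuous_map (subtopology (powertop_real UNIV) (standard_simplex 1)) euclideanreal (\<lambda>x. x 1)"
    by (metis (mono_tags) UNIV_I continuous_map_from_subtopology continuous_map_product_projection)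
  then have proj: "continuous_map (subtopology (powertop_real UNIV) (standard_simplex 1))
      (top_of_set {0..1}) (\<lambda>x. x 1)"
    unfolding continuous_map_in_subtopology by (auto simp: standard_simplex_def)
  have "continuous_map (top_of_set {0..1}) (top_of_set (sphere 0 1)) ?p"
    using path_image_circlepath[of 0 1] path_circlepath[of 0 1]
    unfolding path_def path_image_def by (auto simp: continuous_map_in_subtopology)
  from continuous_map_compose[OF proj this]
  have "singular_simplex 1 (top_of_set (sphere 0 1)) (path_simplex ?p)"
    by (simp add: singular_simplex_def path_simplex_def o_def)
  moreover have "singular_face 1 0 (path_simplex ?p) = singular_face 1 1 (path_simplex ?p)"
  proof -
    have "path_simplex ?p (simplical_face k x) = 1" if "k \<le> 1" "x \<in> standard_simplex 0" for k x
    proof -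
      have "simplical_face k x \<in> standard_simplex 1"
        using simplical_face_in_standard_simplex[of 1 k x] that by simp
      moreover have "simplical_face k x 1 = 0 \<or> simplical_face k x 1 = 1"
        using that by (auto simp: simplical_face_def standard_simplex_0)
      ultimately show ?thesis
        by (auto simp: path_simplex_def circlepath)
    qed
    then show ?thesis
      unfolding singular_face_def by (intro restrict_ext) simp
  qed
  ultimately show ?thesis
    by (simp add: singular_cycle singular_chain_of chain_boundary_of)
qed

text \<open>Every circle is an affine image of the unit circle, so a homotopy between two affine maps on
  the unit circle yields a homology between the two image circles.\<close>

lemma path_simplex_circlepath:
  "path_simplex (circlepath z r) =
     simplex_map 1 (\<lambda>w. z + of_real r * w) (path_simplex (circlepath 0 1))"
  by (rule ext) (simp add: path_simplex_def simplex_map_def restrict_def circlepath)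

lemma homologous_loops_circlepath:
  assumes "\<And>w. norm w = 1 \<Longrightarrow> closed_segment (z + of_real r * w) (z' + of_real r' * w) \<subseteq> S"
  shows "homologous_loops S (circlepath z r) (circlepath z' r')"
proof -
  have "homotopic_with_canon (\<lambda>h. True) (sphere 0 1) S
     (\<lambda>w. z + of_real r * w) (\<lambda>w. z' + of_real r' * w)"
    using assms by (intro homotopic_with_linear continuous_intros) auto
  then have "homotopic_with (\<lambda>h. h \<in> {} \<rightarrow> {}) (top_of_set (sphere 0 1)) (top_of_set S)
     (\<lambda>w. z + of_real r * w) (\<lambda>w. z' + of_real r' * w)"
    by simp
  from homotopic_imp_homologous_rel_chain_maps[OF this unit_circle_relcycle]
  show ?thesis
    by (simp add: homologous_loops_def path_simplex_circlepath[of z r]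
        path_simplex_circlepath[of z' r'])
qed

text \<open>A circle that winds around 0 is deformed to one centred at 0 by the straight-line homotopy.
  At each stage the curve is again a circle whose radius exceeds the distance of its centre
  from 0, so it never meets 0.\<close>

lemma homologous_loops_punctured_disk:
  assumes "norm z < r" "norm z + r < 1" "0 < q" "q < 1"
  shows "homologous_loops punctured_disk (circlepath z r) (circlepath 0 q)"
proof (rule homologous_loops_circlepath)
  fix w :: complex assume w: "norm w = 1"
  show "closed_segment (z + of_real r * w) (0 + of_real q * w) \<subseteq> punctured_disk"
  proof
    fix x assume "x \<in> closed_segment (z + of_real r * w) (0 + of_real q * w)"
    then obtain t where t: "0 \<le> t" "t \<le> 1"
      and "x = (1 - t) *\<^sub>R (z + of_real r * w) + t *\<^sub>R (0 + of_real q * w)"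
      by (auto simp: in_segment)
    then have x: "x = of_real ((1 - t) * r + t * q) * w + of_real (1 - t) * z"
      by (simp add: scaleR_conv_of_real algebra_simps)
    define m where "m = (1 - t) * r + t * q"
    have m0: "0 \<le> m"
      unfolding m_def using t assms norm_ge_zero[of z] by (intro add_nonneg_nonneg mult_nonneg_nonneg) linarith+
    have n: "norm (of_real m * w) = m" "norm (of_real (1 - t) * z) = (1 - t) * norm z"
      using m0 w t by (simp_all add: norm_mult del: of_real_diff)
    have "0 < (1 - t) * (r - norm z) + t * q" "(1 - t) * (r + norm z) + t * q < 1"
    proof -
      show "0 < (1 - t) * (r - norm z) + t * q"
        using convex_bound_lt[of "- (r - norm z)" 0 "- q" "1 - t" t] assms t by (simp add: algebra_simps)
      show "(1 - t) * (r + norm z) + t * q < 1"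
        using convex_bound_lt[of "r + norm z" 1 q "1 - t" t] assms t by simp
    qed
    then have "(1 - t) * norm z < m" "m + (1 - t) * norm z < 1"
      by (simp_all add: m_def algebra_simps)
    then show "x \<in> punctured_disk"
      using norm_triangle_ineq[of "of_real m * w" "of_real (1 - t) * z"]
        norm_diff_ineq[of "of_real m * w" "of_real (1 - t) * z"]
      unfolding punctured_disk_def x m_def[symmetric] mem_Collect_eq n by linarith
  qed
qed

section \<open>Geodesic curvature of Euclidean circles\<close>

lemma ln_hyp_density:
  assumes "0 < norm z" "norm z < 1"
  shows "ln (hyp_density z) = - ln (norm z) - ln (- ln (norm z))"
proof -
  have "hyp_density z = inverse (norm z * (- ln (norm z)))"
    by (simp add: hyp_density_def divide_inverse)
  also have "ln \<dots> = - ln (norm z * (- ln (norm z)))"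
    by (rule ln_inverse)
  also have "\<dots> = - (ln (norm z) + ln (- ln (norm z)))"
    by (subst ln_mult) (use assms in auto)
  finally show ?thesis
    by simp
qed

lemma hyp_density_pos:
  assumes "0 < norm z" "norm z < 1"
  shows "0 < hyp_density z"
  using assms by (simp add: hyp_density_def divide_neg_neg mult_pos_neg)

text \<open>The derivative changes sign at \<open>r = 1 / e\<close>: the horocycle of length \<open>2 * pi\<close> is
  where the logarithm of the density is smallest.  The whole example rests on this.\<close>

lemma DERIV_radial_log_density:
  assumes "0 < r" "r < 1"
  shows "((\<lambda>r. - ln r - ln (- ln r)) has_real_derivative (1 / (- ln r) - 1) / r) (at r)"
proof -
  have "ln r < 0" using assms by simp
  then show ?thesis
    using assms by (auto intro!: derivative_eq_intros simp: field_simps)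
qed

lemma has_derivative_ln_hyp_density:
  assumes "0 < norm z" "norm z < 1"
  shows "((\<lambda>x. ln (hyp_density x)) has_derivative
           (\<lambda>h. (1 / (- ln (norm z)) - 1) / (norm z)\<^sup>2 * (z \<bullet> h))) (at z)"
proof (rule has_derivative_transform_within_open)
  have "z \<noteq> 0" using assms by auto
  have "((\<lambda>x. - ln (norm x) - ln (- ln (norm x))) has_derivative
      (\<lambda>h. (h \<bullet> sgn z) * ((1 / (- ln (norm z)) - 1) / norm z))) (at z)"
    by (rule DERIV_compose_FDERIV[OF DERIV_radial_log_density[OF assms] has_derivative_norm[OF \<open>z \<noteq> 0\<close>]])
  moreover have "(\<lambda>h. (h \<bullet> sgn z) * ((1 / (- ln (norm z)) - 1) / norm z))
      = (\<lambda>h. (1 / (- ln (norm z)) - 1) / (norm z)\<^sup>2 * (z \<bullet> h))"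
    by (rule ext) (simp add: sgn_div_norm inner_commute power2_eq_square divide_simps)
  ultimately show "((\<lambda>x. - ln (norm x) - ln (- ln (norm x))) has_derivative
      (\<lambda>h. (1 / (- ln (norm z)) - 1) / (norm z)\<^sup>2 * (z \<bullet> h))) (at z)"
    by (simp only:)
  show "open (ball 0 1 - {0::complex})"
    by (simp add: open_delete)
  show "z \<in> ball 0 1 - {0}"
    using assms by auto
  show "- ln (norm x) - ln (- ln (norm x)) = ln (hyp_density x)" if "x \<in> ball 0 1 - {0}" for x :: complex
    using that by (simp add: ln_hyp_density)
qed

lemma gradient_ln_hyp_density:
  assumes "0 < norm z" "norm z < 1"
  shows "gradient (\<lambda>x. ln (hyp_density x)) z = ((1 / (- ln (norm z)) - 1) / (norm z)\<^sup>2) *\<^sub>R z"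
proof -
  have "dir_deriv v (\<lambda>x. ln (hyp_density x)) z
      = (1 / (- ln (norm z)) - 1) / (norm z)\<^sup>2 * (z \<bullet> v)" for v
    unfolding dir_deriv_def
    using frechet_derivative_at[OF has_derivative_ln_hyp_density[OF assms]] by metis
  then show ?thesis
    unfolding gradient_def by (simp only: complex_eq_iff) (simp add: inner_complex_def)
qed

text \<open>This is \<open>(1 / (2 * pi)) * d (arg \<gamma>) / dt\<close> along the circle \<open>\<gamma>\<close> with centre
  \<open>z\<^sub>0\<close> and radius \<open>r\<close>: the radial function \<open>ln (norm z)\<close> has normal
  derivative equal to the tangential derivative of the argument.\<close>

definition angular_speed :: "complex \<Rightarrow> real \<Rightarrow> real \<Rightarrow> real" where
  "angular_speed z\<^sub>0 r t = r * (circlepath z\<^sub>0 r t \<bullet> cis (2 * pi * t)) / (norm (circlepath z\<^sub>0 r t))\<^sup>2"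

lemma circlepath_bounds:
  assumes "0 \<le> r"
  shows "r - norm z\<^sub>0 \<le> norm (circlepath z\<^sub>0 r t)" "norm (circlepath z\<^sub>0 r t) \<le> r + norm z\<^sub>0"
  using norm_diff_ineq[of "of_real r * cis (2 * pi * t)" z\<^sub>0]
    norm_triangle_ineq[of "of_real r * cis (2 * pi * t)" z\<^sub>0] assms
  by (simp_all add: circlepath_cis norm_mult add.commute)

text \<open>Apart from \<open>z\<^sub>0\<close> and \<open>r\<close>, the angular speed only depends on the distance to 0.
  Hence all pointwise estimates below reduce to one real variable.\<close>

lemma angular_speed_eq:
  assumes "circlepath z\<^sub>0 r t \<noteq> 0"
  shows "angular_speed z\<^sub>0 r t = (1 + (r\<^sup>2 - (norm z\<^sub>0)\<^sup>2) / (norm (circlepath z\<^sub>0 r t))\<^sup>2) / 2"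
proof -
  define z where "z = circlepath z\<^sub>0 r t"
  define w where "w = cis (2 * pi * t)"
  have "z\<^sub>0 = z - r *\<^sub>R w"
    by (simp add: z_def w_def circlepath_cis scaleR_conv_of_real)
  then have "(norm z\<^sub>0)\<^sup>2 = (norm z)\<^sup>2 - 2 * (r * (z \<bullet> w)) + r\<^sup>2 * (w \<bullet> w)"
    unfolding power2_norm_eq_inner
    by (simp add: inner_diff_left inner_diff_right inner_commute power2_eq_square)
  moreover have "w \<bullet> w = 1"
    by (simp add: w_def flip: power2_norm_eq_inner)
  ultimately have "2 * (r * (z \<bullet> w)) = (norm z)\<^sup>2 + (r\<^sup>2 - (norm z\<^sub>0)\<^sup>2)"
    by simp
  then show ?thesis
    using assms unfolding angular_speed_def z_def[symmetric] w_def[symmetric]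
    by (simp add: field_simps)
qed

text \<open>Geodesic curvature times length element is the Euclidean turning \<open>2 * pi * dt\<close> plus the
  outward normal derivative of the logarithm of the density times the Euclidean length element.  That
  derivative is radial, which is why it enters as a multiple of the angular speed.\<close>

lemma geodesic_curvature_circlepath:
  assumes "0 < r" "0 < norm (circlepath z\<^sub>0 r t)" "norm (circlepath z\<^sub>0 r t) < 1"
  shows "geodesic_curvature hyp_density (circlepath z\<^sub>0 r) t
    = (1 + (1 / (- ln (norm (circlepath z\<^sub>0 r t))) - 1) * angular_speed z\<^sub>0 r t)
       / (r * hyp_density (circlepath z\<^sub>0 r t))"
    and "metric_norm hyp_density (circlepath z\<^sub>0 r t) (velocity (circlepath z\<^sub>0 r) t)
    = 2 * pi * r * hyp_density (circlepath z\<^sub>0 r t)"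
proof -
  define z where "z = circlepath z\<^sub>0 r t"
  define w where "w = cis (2 * pi * t)"
  define v where "v = velocity (circlepath z\<^sub>0 r) t"
  define \<rho> where "\<rho> = hyp_density z"
  define k where "k = (1 / (- ln (norm z)) - 1) / (norm z)\<^sup>2"
  have rho: "0 < \<rho>"
    unfolding \<rho>_def using assms by (intro hyp_density_pos) (simp_all add: z_def)
  have v: "v = (2 * pi * r) *\<^sub>R (\<i> * w)"
    by (simp add: v_def velocity_circlepath w_def scaleR_conv_of_real)
  have ww: "w \<bullet> w = 1"
    by (simp add: w_def flip: power2_norm_eq_inner)
  have vw: "v \<bullet> w = 0"
    unfolding v by (simp add: inner_complex_def)
  have "(\<i> * w) \<bullet> (\<i> * w) = w \<bullet> w"
    by (simp add: inner_complex_def)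
  then have vv: "v \<bullet> v = (2 * pi * r)\<^sup>2"
    unfolding v using ww by (simp add: power2_eq_square)
  have grad: "gradient (\<lambda>x. ln (hyp_density x)) z = k *\<^sub>R z"
    unfolding k_def using assms by (intro gradient_ln_hyp_density) (simp_all add: z_def)
  have acc: "covariant_acceleration hyp_density (circlepath z\<^sub>0 r) t
      = - (4 * pi\<^sup>2 * r) *\<^sub>R w + (2 * ((k *\<^sub>R z) \<bullet> v)) *\<^sub>R v - ((2 * pi * r)\<^sup>2 * k) *\<^sub>R z"
    unfolding covariant_acceleration_def velocity_velocity_circlepath christoffel_def Let_def
      z_def[symmetric] w_def[symmetric] v_def[symmetric] grad vv
    by (simp add: scaleR_conv_of_real)
  have "covariant_acceleration hyp_density (circlepath z\<^sub>0 r) t \<bullet> (- w)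
      = 4 * pi\<^sup>2 * r + (2 * pi * r)\<^sup>2 * k * (z \<bullet> w)"
    unfolding acc by (simp add: inner_add_left inner_diff_left ww vw)
  also have "\<dots> = 4 * pi\<^sup>2 * r * (1 + (1 / (- ln (norm z)) - 1) * angular_speed z\<^sub>0 r t)"
    unfolding angular_speed_def z_def[symmetric] w_def[symmetric] k_def
    by (simp add: power2_eq_square algebra_simps)
  finally have turn: "covariant_acceleration hyp_density (circlepath z\<^sub>0 r) t \<bullet> (- w) = \<dots>" .
  show "metric_norm hyp_density (circlepath z\<^sub>0 r t) (velocity (circlepath z\<^sub>0 r) t)
    = 2 * pi * r * hyp_density (circlepath z\<^sub>0 r t)"
  proof -
    have "metric_norm hyp_density z v = sqrt ((2 * pi * r * \<rho>)\<^sup>2)"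
      by (simp add: metric_norm_def metric_inner_def vv \<rho>_def power_mult_distrib mult_ac)
    then show ?thesis
      using rho assms(1) by (simp add: z_def v_def \<rho>_def)
  qed
  have "geodesic_curvature hyp_density (circlepath z\<^sub>0 r) t
      = \<rho>\<^sup>2 * ((covariant_acceleration hyp_density (circlepath z\<^sub>0 r) t \<bullet> (- w)) / \<rho>)
         / (\<rho>\<^sup>2 * (2 * pi * r)\<^sup>2)"
    unfolding geodesic_curvature_def metric_inner_def inner_normal_circlepath[OF assms(1)]
      z_def[symmetric] w_def[symmetric] v_def[symmetric] vv \<rho>_def[symmetric]
    by (simp add: divide_inverse)
  also have "\<dots> = (1 + (1 / (- ln (norm z)) - 1) * angular_speed z\<^sub>0 r t) / (r * \<rho>)"
    unfolding turn using rho assms(1) by (simp add: power2_eq_square divide_simps)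
  finally show "geodesic_curvature hyp_density (circlepath z\<^sub>0 r) t
    = (1 + (1 / (- ln (norm (circlepath z\<^sub>0 r t))) - 1) * angular_speed z\<^sub>0 r t)
       / (r * hyp_density (circlepath z\<^sub>0 r t))"
    by (simp add: z_def \<rho>_def)
qed

text \<open>The winding number around 0 is 1; the integral is the imaginary part of the
  Cauchy integral of \<open>1 / z\<close>.\<close>

lemma has_integral_angular_speed:
  assumes "norm z\<^sub>0 < r"
  shows "(angular_speed z\<^sub>0 r has_integral 1) {0..1}"
proof -
  have r: "0 < r"
    using assms norm_ge_zero[of z\<^sub>0] by linarith
  have "((\<lambda>u. 1 / (u - 0)) has_contour_integral (2 * of_real pi * \<i> * 1)) (circlepath z\<^sub>0 r)"
    using assms by (intro Cauchy_integral_circlepath_simple) auto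
  then have "((\<lambda>t. 1 / circlepath z\<^sub>0 r t * (2 * pi * \<i> * r * exp (2 * of_real pi * \<i> * t)))
      has_integral (2 * of_real pi * \<i>)) {0..1}"
    unfolding has_contour_integral_def
    by (rule has_integral_eq_rhs[OF has_integral_eq, rotated 1])
       (simp_all add: vector_derivative_circlepath01)
  from has_integral_linear[OF this bounded_linear_Im]
  have "((\<lambda>t. Im (1 / circlepath z\<^sub>0 r t * (2 * pi * \<i> * r * exp (2 * of_real pi * \<i> * t))))
      has_integral (2 * pi)) {0..1}"
    by (simp add: o_def)
  moreover have "Im (1 / circlepath z\<^sub>0 r t * (2 * pi * \<i> * r * exp (2 * of_real pi * \<i> * t)))
      = 2 * pi * angular_speed z\<^sub>0 r t" for t
  proof -
    have "exp (2 * of_real pi * \<i> * t) = cis (2 * pi * t)"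
      by (simp add: cis_conv_exp mult_ac)
    then show ?thesis
      by (simp add: angular_speed_def Im_divide inner_complex_def cmod_power2 field_simps)
  qed
  ultimately have "((\<lambda>t. 2 * pi * angular_speed z\<^sub>0 r t) has_integral (2 * pi)) {0..1}"
    by (simp only:)
  from has_integral_mult_right[OF this, of "1 / (2 * pi)"] show ?thesis
    by simp
qed

text \<open>With \<open>A = (norm z)\<^sup>2\<close> and \<open>P = r\<^sup>2 - (norm z\<^sub>0)\<^sup>2\<close> the claim
  is \<open>- ln A < 1 + P / A\<close>.  For the critical value \<open>P = exp (- 2)\<close> this is the inequality
  \<open>1 + x \<le> exp x\<close> at \<open>x = - 2 - ln A\<close>, with equality on the horocycle
  \<open>A = exp (- 2)\<close>; hence a larger \<open>P\<close> gives strict inequality everywhere.\<close>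

lemma angular_speed_div_gt_1:
  assumes "exp (- 2) < r\<^sup>2 - (norm z\<^sub>0)\<^sup>2" "0 < norm (circlepath z\<^sub>0 r t)" "norm (circlepath z\<^sub>0 r t) < 1"
  shows "1 < 1 / (- ln (norm (circlepath z\<^sub>0 r t))) * angular_speed z\<^sub>0 r t"
proof -
  define z where "z = circlepath z\<^sub>0 r t"
  have z: "0 < norm z" "norm z < 1" "z \<noteq> 0"
    using assms by (auto simp: z_def)
  have "1 + (- 2 - 2 * ln (norm z)) \<le> exp (- 2 - 2 * ln (norm z))"
    by (rule exp_ge_add_one_self)
  also have "\<dots> = exp (- 2) / (norm z)\<^sup>2"
    using z by (simp only: exp_diff exp_double exp_ln)
  also have "\<dots> < (r\<^sup>2 - (norm z\<^sub>0)\<^sup>2) / (norm z)\<^sup>2"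
    using z assms by (intro divide_strict_right_mono) auto
  finally have "- ln (norm z) < angular_speed z\<^sub>0 r t"
    using z by (subst angular_speed_eq) (simp_all add: z_def)
  then show ?thesis
    using z by (simp add: z_def[symmetric] field_simps)
qed

text \<open>The integrand, divided by \<open>2 * pi\<close>, is \<open>1 - \<psi> + \<psi> / L\<close> with \<open>\<psi>\<close> the
  angular speed and \<open>L = - ln (norm z)\<close>.  The part \<open>1 - \<psi>\<close> integrates to 0 because
  the curve winds once around 0, and \<open>\<psi> / L\<close> exceeds 1 pointwise.\<close>

lemma total_geodesic_curvature_circlepath_gt:
  assumes "norm z\<^sub>0 < r" "r + norm z\<^sub>0 < 1" "exp (- 2) < r\<^sup>2 - (norm z\<^sub>0)\<^sup>2"
  shows "2 * pi < total_geodesic_curvature hyp_density (circlepath z\<^sub>0 r)"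
proof -
  let ?\<gamma> = "circlepath z\<^sub>0 r" and ?\<psi> = "angular_speed z\<^sub>0 r"
  let ?k = "\<lambda>t. 2 * pi * (1 + (1 / (- ln (norm (?\<gamma> t))) - 1) * ?\<psi> t)"
  have r: "0 < r"
    using assms norm_ge_zero[of z\<^sub>0] by linarith
  have z: "0 < norm (?\<gamma> t)" "norm (?\<gamma> t) < 1" for t
    using circlepath_bounds[of r z\<^sub>0 t] r assms by linarith+
  have nz: "?\<gamma> t \<noteq> 0" "ln (norm (?\<gamma> t)) \<noteq> 0" for t
    using z[of t] by (auto simp: ln_eq_zero_iff)
  have "geodesic_curvature hyp_density ?\<gamma> t * metric_norm hyp_density (?\<gamma> t) (velocity ?\<gamma> t) = ?k t" for t
    using r hyp_density_pos[OF z, of t]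
    unfolding geodesic_curvature_circlepath[OF r z] by (simp add: field_simps)
  then have total: "total_geodesic_curvature hyp_density ?\<gamma> = integral {0..1} ?k"
    by (simp add: total_geodesic_curvature_def)
  have "((\<lambda>t. 2 * pi * (2 - ?\<psi> t)) has_integral 2 * pi * (2 - 1)) {0..1}"
    using has_integral_const_real[of "2::real" 0 1]
    by (intro has_integral_mult_right has_integral_diff has_integral_angular_speed assms) simp_all
  then have "((\<lambda>t. 2 * pi * (2 - ?\<psi> t)) has_integral 2 * pi) {0..1}"
    by (rule has_integral_eq_rhs) simp
  then have "2 * pi = integral {0..1} (\<lambda>t. 2 * pi * (2 - ?\<psi> t))"
    by (rule integral_unique[symmetric])
  also have "\<dots> < integral {0..1} ?k"
  proof (rule integral_less_real)
    have cont: "continuous_on {0..1} ?\<gamma>"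
      using path_circlepath[of z\<^sub>0 r] by (simp add: path_def)
    have psi: "continuous_on {0..1} ?\<psi>"
      unfolding angular_speed_def cis_conv_exp by (intro continuous_intros cont) (simp add: nz)
    show "continuous_on {0..1} (\<lambda>t. 2 * pi * (2 - ?\<psi> t))"
      by (intro continuous_intros psi)
    show "continuous_on {0..1} ?k"
      by (intro continuous_intros psi cont) (simp_all add: nz)
    show "2 * pi * (2 - ?\<psi> t) < ?k t" for t
    proof (rule mult_strict_left_mono)
      show "2 - ?\<psi> t < 1 + (1 / (- ln (norm (?\<gamma> t))) - 1) * ?\<psi> t"
        using angular_speed_div_gt_1[OF assms(3) z, of t] by (simp add: algebra_simps)
    qed simp
  qed simp
  finally show ?thesis
    by (simp add: total)
qed

text \<open>The curvature is a positive multiple of \<open>1 + (1 / L - 1) * \<psi>\<close>.  The hypotheses give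
  \<open>L \<le> 2\<close> and \<open>\<psi> \<le> 2\<close>, so the negative contribution is at most 1.\<close>

lemma convex_curve_circlepath:
  assumes "norm z\<^sub>0 < r" "r + norm z\<^sub>0 < 1"
    and "exp (- 2) \<le> r - norm z\<^sub>0" "r + norm z\<^sub>0 \<le> 3 * (r - norm z\<^sub>0)"
  shows "convex_curve hyp_density (circlepath z\<^sub>0 r)"
  unfolding convex_curve_def
proof
  fix t
  define z where "z = circlepath z\<^sub>0 r t"
  have r: "0 < r"
    using assms norm_ge_zero[of z\<^sub>0] by linarith
  have z: "r - norm z\<^sub>0 \<le> norm z" "0 < norm z" "norm z < 1"
    using circlepath_bounds[of r z\<^sub>0 t] r assms unfolding z_def by linarith+
  define L where "L = - ln (norm z)"
  have "ln (exp (- 2)) \<le> ln (norm z)"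
    using z assms(3) by (subst ln_le_cancel_iff) auto
  then have L: "0 < L" "L \<le> 2"
    using z by (simp_all add: L_def)
  have "r\<^sup>2 - (norm z\<^sub>0)\<^sup>2 = (r + norm z\<^sub>0) * (r - norm z\<^sub>0)"
    by (simp add: power2_eq_square algebra_simps)
  also have "\<dots> \<le> (3 * (r - norm z\<^sub>0)) * (r - norm z\<^sub>0)"
    using assms by (intro mult_right_mono) auto
  also have "\<dots> \<le> 3 * (norm z)\<^sup>2"
    using power_mono[OF z(1), of 2] assms(1) unfolding power2_eq_square mult.assoc by simp
  finally have ratio: "(r\<^sup>2 - (norm z\<^sub>0)\<^sup>2) / (norm z)\<^sup>2 \<le> 3"
    using z by (simp add: divide_le_eq)
  have pos: "0 \<le> (r\<^sup>2 - (norm z\<^sub>0)\<^sup>2) / (norm z)\<^sup>2"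
    using assms(1) by (simp add: power_mono)
  have psi: "0 \<le> angular_speed z\<^sub>0 r t" "angular_speed z\<^sub>0 r t \<le> 2"
    using ratio pos z by (simp_all add: angular_speed_eq z_def)
  have "(- (1 / 2)) * angular_speed z\<^sub>0 r t \<le> (1 / L - 1) * angular_speed z\<^sub>0 r t"
    using L psi by (intro mult_right_mono) (simp_all add: field_simps)
  then have "0 \<le> 1 + (1 / L - 1) * angular_speed z\<^sub>0 r t"
    using psi by linarith
  then show "0 \<le> geodesic_curvature hyp_density (circlepath z\<^sub>0 r) t"
    using geodesic_curvature_circlepath(1)[of r z\<^sub>0 t] hyp_density_pos[of z] z r
    by (simp add: z_def L_def)
qed

section \<open>The maximum principle\<close>

lemma DERIV_along_line:
  assumes "u differentiable (at (z + t *\<^sub>R v))"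
  shows "((\<lambda>t. u (z + t *\<^sub>R v)) has_real_derivative dir_deriv v u (z + t *\<^sub>R v)) (at t)"
proof -
  have "((\<lambda>t. z + t *\<^sub>R v) has_derivative (\<lambda>h. h *\<^sub>R v)) (at t)"
    by (auto intro!: derivative_eq_intros)
  from has_derivative_compose[OF this assms[unfolded frechet_derivative_works]]
  have "((\<lambda>t. u (z + t *\<^sub>R v)) has_derivative
          (\<lambda>h. frechet_derivative u (at (z + t *\<^sub>R v)) (h *\<^sub>R v))) (at t)" .
  moreover have "frechet_derivative u (at (z + t *\<^sub>R v)) (h *\<^sub>R v) = dir_deriv v u (z + t *\<^sub>R v) * h" for h
    using linear_scale[OF linear_frechet_derivative[OF assms], of h v] by (simp add: dir_deriv_def)
  ultimately show ?thesis
    by (simp add: has_field_derivative_def)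
qed

text \<open>The second derivative test at a maximum, for \<open>u\<close> minus a linear function along a line.
  The linear term \<open>t * b\<close> does not affect the second derivative.\<close>

lemma second_dir_deriv_nonpos:
  assumes d: "0 < d"
    and diff: "\<And>t. \<bar>t\<bar> < d \<Longrightarrow> u differentiable (at (z + t *\<^sub>R v))"
    and diff2: "dir_deriv v u differentiable (at z)"
    and max: "\<And>t. \<bar>t\<bar> < d \<Longrightarrow> u (z + t *\<^sub>R v) - t * b \<le> u z"
  shows "dir_deriv v (dir_deriv v u) z \<le> 0"
proof (rule ccontr)
  assume neg: "\<not> ?thesis"
  define f where "f t = u (z + t *\<^sub>R v) - t * b" for t
  define g where "g t = dir_deriv v u (z + t *\<^sub>R v) - b" for t
  have f': "(f has_real_derivative g t) (at t)" if "\<bar>t\<bar> < d" for t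
    unfolding f_def g_def using DERIV_along_line[OF diff[OF that]]
    by (auto intro!: derivative_eq_intros)
  have "g 0 = 0"
  proof (rule DERIV_local_max[OF f' d])
    show "\<forall>y. \<bar>0 - y\<bar> < d \<longrightarrow> f y \<le> f 0"
      using max by (simp add: f_def)
  qed (use d in simp)
  have "((\<lambda>t. dir_deriv v u (z + t *\<^sub>R v)) has_real_derivative dir_deriv v (dir_deriv v u) z) (at 0)"
    using DERIV_along_line[of "dir_deriv v u" z 0 v] diff2 by simp
  then have "(g has_real_derivative dir_deriv v (dir_deriv v u) z) (at 0)"
    unfolding g_def by (auto intro!: derivative_eq_intros)
  then obtain e where e: "0 < e" "\<And>h. 0 < h \<Longrightarrow> h < e \<Longrightarrow> g 0 < g (0 + h)"
    using DERIV_pos_inc_right neg by (metis not_le)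
  define h where "h = min d e / 2"
  have h: "0 < h" "h < d" "h < e"
    using d e(1) by (auto simp: h_def)
  have "f 0 < f h"
  proof (rule DERIV_pos_imp_increasing_open[OF h(1)])
    show "\<exists>y. (f has_real_derivative y) (at t) \<and> 0 < y" if "0 < t" "t < h" for t
      using f'[of t] e(2)[of t] that h \<open>g 0 = 0\<close> by (intro exI[of _ "g t"]) auto
    show "continuous_on {0..h} f"
      using h by (intro continuous_at_imp_continuous_on ballI DERIV_isCont[OF f']) auto
  qed
  then show False
    using max[of h] h by (simp add: f_def)
qed

text \<open>The maximum principle for \<open>u\<close> minus an affine, hence harmonic, function: at an interior
  maximum both second derivatives in the Laplacian would be nonpositive.\<close>

lemma subharmonic_le_affine:
  fixes u :: "complex \<Rightarrow> real"
  assumes S: "open S" "cball c s \<subseteq> S" and u: "C2_on S u"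
    and lap: "\<And>z. z \<in> S \<Longrightarrow> 0 < laplacian u z"
    and bd: "\<And>z. z \<in> sphere c s \<Longrightarrow> u z \<le> a + b \<bullet> z"
    and z: "z \<in> cball c s"
  shows "u z \<le> a + b \<bullet> z"
proof -
  define f where "f z = u z - b \<bullet> z" for z
  have "continuous_on (cball c s) u"
    using u S(2) by (intro continuous_at_imp_continuous_on)
      (auto simp: C2_on_def intro: differentiable_imp_continuous_within)
  then have "continuous_on (cball c s) f"
    unfolding f_def by (intro continuous_intros)
  moreover have "cball c s \<noteq> {}"
    using z by blast
  ultimately obtain p where p: "p \<in> cball c s" "\<And>y. y \<in> cball c s \<Longrightarrow> f y \<le> f p"
    using continuous_attains_sup[OF compact_cball] by metis
  have "p \<notin> ball c s"
  proof
    assume "p \<in> ball c s"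
    then obtain e where e: "0 < e" "ball p e \<subseteq> ball c s"
      using openE[OF open_ball] by metis
    have nonpos: "dir_deriv v (dir_deriv v u) p \<le> 0" if v: "norm v = 1" for v
    proof (rule second_dir_deriv_nonpos[OF e(1), of u p v "b \<bullet> v"])
      have near: "p + t *\<^sub>R v \<in> cball c s" if "\<bar>t\<bar> < e" for t
      proof -
        have "p + t *\<^sub>R v \<in> ball p e"
          using that v by (simp add: dist_norm)
        then show ?thesis
          using e(2) ball_subset_cball by blast
      qed
      show "u differentiable (at (p + t *\<^sub>R v))" if "\<bar>t\<bar> < e" for t
        using near[OF that] u S(2) by (auto simp: C2_on_def)
      show "dir_deriv v u differentiable (at p)"
        using p(1) u S(2) by (auto simp: C2_on_def)
      show "u (p + t *\<^sub>R v) - t * (b \<bullet> v) \<le> u p" if "\<bar>t\<bar> < e" for t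
        using p(2)[OF near[OF that]] by (simp add: f_def inner_add_right)
    qed
    have "laplacian u p \<le> 0"
      using nonpos[of 1] nonpos[of \<i>] by (simp add: laplacian_def)
    moreover have "0 < laplacian u p"
      using lap p(1) S(2) by blast
    ultimately show False
      by simp
  qed
  with p(1) have "p \<in> sphere c s"
    by auto
  with bd have "f p \<le> a"
    by (fastforce simp: f_def)
  with p(2)[OF z] show ?thesis
    by (simp add: f_def)
qed

section \<open>Circles without a negatively curved completion\<close>

text \<open>The logarithm of the density is bounded above by a function affine in \<open>r\<^sup>2\<close> that agrees with it
  at \<open>r\<^sub>0\<close>.  On a circle, \<open>(norm z)\<^sup>2\<close> is itself an affine function of
  \<open>z\<close>, so such a bound is the restriction of an affine function on the plane.\<close>

lemma radial_log_density_le: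
  fixes r\<^sub>0 r r\<^sub>1 :: real
  assumes "0 < r\<^sub>0" "r\<^sub>0 \<le> r" "r \<le> r\<^sub>1" "r\<^sub>1 < 1" "- ln r\<^sub>1 \<le> 1"
  shows "(- ln r - ln (- ln r)) - (- ln r\<^sub>0 - ln (- ln r\<^sub>0))
    \<le> (1 / (- ln r\<^sub>1) - 1) / (2 * r\<^sub>0\<^sup>2) * (r\<^sup>2 - r\<^sub>0\<^sup>2)"
proof -
  define L\<^sub>0 L L\<^sub>1 where "L\<^sub>0 = - ln r\<^sub>0" and "L = - ln r" and "L\<^sub>1 = - ln r\<^sub>1"
  have L: "0 < L\<^sub>1" "L\<^sub>1 \<le> L" "L \<le> L\<^sub>0" "L\<^sub>1 \<le> 1"
    using assms by (auto simp: L\<^sub>0_def L_def L\<^sub>1_def)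
  have "ln L\<^sub>0 - ln L = ln (L\<^sub>0 / L)"
    using L by (simp add: ln_div)
  also have "\<dots> \<le> L\<^sub>0 / L - 1"
    using L by (intro ln_le_minus_one) simp
  also have "\<dots> = (L\<^sub>0 - L) * (1 / L)"
    using L by (simp add: field_simps)
  also have "\<dots> \<le> (L\<^sub>0 - L) * (1 / L\<^sub>1)"
    using L by (intro mult_left_mono) (simp_all add: frac_le)
  finally have "(L - ln L) - (L\<^sub>0 - ln L\<^sub>0) \<le> (L\<^sub>0 - L) * (1 / L\<^sub>1 - 1)"
    by (simp add: right_diff_distrib)
  also have "\<dots> \<le> (r\<^sup>2 - r\<^sub>0\<^sup>2) / (2 * r\<^sub>0\<^sup>2) * (1 / L\<^sub>1 - 1)"
  proof (rule mult_right_mono)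
    have "2 * (L\<^sub>0 - L) = ln ((r / r\<^sub>0)\<^sup>2)"
      using assms by (simp add: L\<^sub>0_def L_def ln_realpow ln_div)
    also have "\<dots> \<le> (r / r\<^sub>0)\<^sup>2 - 1"
      using assms by (intro ln_le_minus_one) simp
    also have "\<dots> = (r\<^sup>2 - r\<^sub>0\<^sup>2) / r\<^sub>0\<^sup>2"
      using assms by (simp add: power_divide diff_divide_distrib)
    finally show "L\<^sub>0 - L \<le> (r\<^sup>2 - r\<^sub>0\<^sup>2) / (2 * r\<^sub>0\<^sup>2)"
      by simp
    show "0 \<le> 1 / L\<^sub>1 - 1"
      using L by simp
  qed
  finally show ?thesis
    by (simp add: L\<^sub>0_def L_def L\<^sub>1_def mult_ac)
qed

text \<open>The obstruction sits at the point \<open>p = c - s\<close> of the circle nearest to 0.  A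
  completion \<open>u\<close> is subharmonic and has prescribed values and, being \<open>C\<^sup>2\<close>, a prescribed gradient
  on the circle.  By the maximum principle \<open>u\<close> lies below an affine function that touches it at
  \<open>p\<close>, which bounds its inward derivative there by the slope \<open>\<beta>\<close>.  The prescribed
  inward derivative comes from the metric outside and exceeds \<open>\<beta>\<close>: this is the content of the
  last hypothesis, both sides of which are multiplied by \<open>s - c\<close>.\<close>

lemma no_negatively_curved_completion_circlepath:
  fixes c s :: real
  assumes c: "0 < c" "c < s" "s + c < 1" and outer: "- ln (s + c) \<le> 1"
    and slopes: "c * (1 / (- ln (s + c)) - 1) / (s - c) < 1 - 1 / (- ln (s - c))"
  shows "\<not> negatively_curved_completion (circlepath (of_real c) s) u"
proof
  assume "negatively_curved_completion (circlepath (of_real c) s) u"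
  then have C2: "C2_on (ball 0 1) u"
    and out: "\<And>z. z \<in> ball 0 1 - ball (of_real c) s \<Longrightarrow> exp (u z) = hyp_density z"
    and curv: "\<And>z. z \<in> ball 0 1 \<Longrightarrow> gaussian_curvature (\<lambda>w. exp (u w)) z < 0"
    using c by (auto simp: negatively_curved_completion_def inside_sphere)
  define r\<^sub>0 where "r\<^sub>0 = s - c"
  define p where "p = complex_of_real (- r\<^sub>0)"
  define \<phi> where "\<phi> r = - ln r - ln (- ln r)" for r :: real
  define \<beta> where "\<beta> = c * (1 / (- ln (s + c)) - 1) / r\<^sub>0\<^sup>2"
  have r0: "0 < r\<^sub>0" "r\<^sub>0 < 1"
    using c by (auto simp: r\<^sub>0_def)
  have disk: "cball (complex_of_real c) s \<subseteq> ball 0 1"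
  proof
    fix z assume "z \<in> cball (complex_of_real c) s"
    then have "norm (z - of_real c) \<le> s"
      by (simp add: dist_norm norm_minus_commute)
    then show "z \<in> ball 0 1"
      using norm_triangle_ineq[of "z - of_real c" "of_real c"] c by simp
  qed
  have lap: "0 < laplacian u z" if "z \<in> ball 0 1" for z
    using curv[OF that] by (simp add: gaussian_curvature_def field_simps)
  have u_out: "u z = \<phi> (norm z)" if "z \<in> ball 0 1" "z \<notin> ball (of_real c) s" for z
  proof -
    have "z \<noteq> 0"
      using that c by (auto simp: dist_norm)
    moreover have "u z = ln (hyp_density z)"
      using out[of z] that by (metis DiffI ln_exp)
    ultimately show ?thesis
      using that by (simp add: \<phi>_def ln_hyp_density)
  qed
  have p: "p \<in> sphere (of_real c) s" "norm p = r\<^sub>0"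
  proof -
    have "complex_of_real c - p = of_real s"
      by (simp add: p_def r\<^sub>0_def)
    then show "p \<in> sphere (of_real c) s"
      using c by (simp add: dist_norm)
    show "norm p = r\<^sub>0"
      using r0 by (simp add: p_def)
  qed
  have u_p: "u p = \<phi> r\<^sub>0"
    using u_out[of p] p r0 by simp

  have "u z \<le> (\<phi> r\<^sub>0 + \<beta> * r\<^sub>0) + of_real \<beta> \<bullet> z" if "z \<in> cball (of_real c) s" for z
  proof (rule subharmonic_le_affine[OF open_ball disk C2 lap _ that])
    fix z assume z: "z \<in> sphere (complex_of_real c) s"
    have eq: "(Re z - c)\<^sup>2 + (Im z)\<^sup>2 = s\<^sup>2"
    proof -
      have "norm (z - of_real c) = s"
        using z by (simp add: dist_norm norm_minus_commute)
      then have "(norm (z - of_real c))\<^sup>2 = s\<^sup>2"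
        by simp
      then show ?thesis
        by (simp add: cmod_power2)
    qed
    have A: "(norm z)\<^sup>2 - r\<^sub>0\<^sup>2 = 2 * c * (Re z + r\<^sub>0)"
      using eq unfolding cmod_power2 by (simp add: r\<^sub>0_def power2_eq_square algebra_simps)
    have dist: "norm (z - of_real c) = s"
      using z by (simp add: dist_norm norm_minus_commute)
    then have upper: "norm z \<le> s + c"
      using norm_triangle_ineq[of "z - of_real c" "of_real c"] c by simp
    have lower: "r\<^sub>0 \<le> norm z"
      using norm_triangle_ineq2[of "z - of_real c" "- of_real c"] c dist by (simp add: r\<^sub>0_def)
    have "u z = \<phi> (norm z)"
      using u_out z disk by auto
    also have "\<dots> \<le> \<phi> r\<^sub>0 + (1 / (- ln (s + c)) - 1) / (2 * r\<^sub>0\<^sup>2) * ((norm z)\<^sup>2 - r\<^sub>0\<^sup>2)"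
      using radial_log_density_le[OF r0(1) lower upper c(3) outer] by (simp add: \<phi>_def)
    also have "\<dots> = (\<phi> r\<^sub>0 + \<beta> * r\<^sub>0) + of_real \<beta> \<bullet> z"
      using r0 unfolding A \<beta>_def by (simp add: inner_complex_def field_simps)
    finally show "u z \<le> (\<phi> r\<^sub>0 + \<beta> * r\<^sub>0) + of_real \<beta> \<bullet> z" .
  qed
  then have inner: "u (p + t *\<^sub>R 1) \<le> \<phi> r\<^sub>0 + \<beta> * t" if "0 \<le> t" "t \<le> 2 * s" for t
  proof -
    have "of_real c - (p + t *\<^sub>R 1) = complex_of_real (s - t)"
      by (simp add: p_def r\<^sub>0_def scaleR_conv_of_real)
    then have "p + t *\<^sub>R 1 \<in> cball (of_real c) s"
      using that by (simp add: dist_norm del: of_real_diff)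
    from \<open>\<And>z. z \<in> cball (of_real c) s \<Longrightarrow> u z \<le> (\<phi> r\<^sub>0 + \<beta> * r\<^sub>0) + of_real \<beta> \<bullet> z\<close>[OF this]
    show ?thesis
      by (simp add: inner_complex_def p_def algebra_simps)
  qed

  have outer_val: "u (p + t *\<^sub>R 1) = \<phi> (r\<^sub>0 - t)" if "t \<le> 0" "r\<^sub>0 - 1 < t" for t
  proof -
    have eq: "p + t *\<^sub>R 1 = - complex_of_real (r\<^sub>0 - t)" "of_real c - (p + t *\<^sub>R 1) = complex_of_real (s - t)"
      by (simp_all add: p_def r\<^sub>0_def scaleR_conv_of_real)
    then have n: "norm (p + t *\<^sub>R 1) = r\<^sub>0 - t"
      using that r0 by (simp del: of_real_diff)
    have "dist (of_real c) (p + t *\<^sub>R 1) = s - t"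
      unfolding dist_norm eq(2) using that c by (simp del: of_real_diff)
    then show ?thesis
      using u_out[of "p + t *\<^sub>R 1"] n that by simp
  qed

  (* The derivative at p in the inward direction is now computed from both sides:
     from inside by comparison with the affine bound, from outside exactly. *)
  define D where "D = dir_deriv 1 u p"
  have "u differentiable (at p)"
    using C2 p r0 by (auto simp: C2_on_def)
  then have D: "((\<lambda>t. u (p + t *\<^sub>R 1)) has_real_derivative D) (at 0)"
    using DERIV_along_line[of u p 0 1] by (simp add: D_def)

  have "D \<le> \<beta>"
  proof (rule ccontr)
    assume "\<not> D \<le> \<beta>"
    then have "0 < D - \<beta>"
      by simp
    have "((\<lambda>t. u (p + t *\<^sub>R 1) - \<beta> * t) has_real_derivative D - \<beta>) (at 0)"
      using D by (auto intro!: derivative_eq_intros)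
    from DERIV_pos_inc_right[OF this \<open>0 < D - \<beta>\<close>] obtain e where e: "0 < e"
      "\<And>h. 0 < h \<Longrightarrow> h < e \<Longrightarrow> u (p + 0 *\<^sub>R 1) - \<beta> * 0 < u (p + (0 + h) *\<^sub>R 1) - \<beta> * (0 + h)"
      by blast
    define h where "h = min e (2 * s) / 2"
    have "0 < h" "h < e" "h \<le> 2 * s"
      using e(1) c by (auto simp: h_def)
    then show False
      using e(2)[of h] inner[of h] u_p by simp
  qed

  moreover have "D = (1 - 1 / (- ln r\<^sub>0)) / r\<^sub>0"
  proof -
    define l where "l = D + (1 / (- ln r\<^sub>0) - 1) / r\<^sub>0"
    have "(\<phi> has_real_derivative (1 / (- ln r\<^sub>0) - 1) / r\<^sub>0) (at (r\<^sub>0 - 0))"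
      unfolding \<phi>_def using DERIV_radial_log_density[OF r0] by simp
    then have "((\<lambda>t. \<phi> (r\<^sub>0 - t)) has_real_derivative (1 / (- ln r\<^sub>0) - 1) / r\<^sub>0 * (- 1)) (at 0)"
      by (rule DERIV_chain2) (auto intro!: derivative_eq_intros)
    from DERIV_diff[OF D this]
    have l: "((\<lambda>t. u (p + t *\<^sub>R 1) - \<phi> (r\<^sub>0 - t)) has_real_derivative l) (at 0)"
      by (simp add: l_def)
    have zero: "u (p + (0 - h) *\<^sub>R 1) - \<phi> (r\<^sub>0 - (0 - h)) = 0" if "0 \<le> h" "h < 1 - r\<^sub>0" for h
      using outer_val[of "0 - h"] that by simp
    have "\<not> 0 < l"
    proof
      assume "0 < l"
      from DERIV_pos_inc_left[OF l this] obtain e where e: "0 < e"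
        "\<And>h. 0 < h \<Longrightarrow> h < e \<Longrightarrow>
          u (p + (0 - h) *\<^sub>R 1) - \<phi> (r\<^sub>0 - (0 - h)) < u (p + 0 *\<^sub>R 1) - \<phi> (r\<^sub>0 - 0)"
        by blast
      define h where "h = min e (1 - r\<^sub>0) / 2"
      have "0 < h" "h < e" "h < 1 - r\<^sub>0"
        using e(1) r0 by (auto simp: h_def)
      then show False
        using e(2)[of h] zero[of h] zero[of 0] r0 by simp
    qed
    moreover have "\<not> l < 0"
    proof
      assume "l < 0"
      from DERIV_neg_dec_left[OF l this] obtain e where e: "0 < e"
        "\<And>h. 0 < h \<Longrightarrow> h < e \<Longrightarrow>
          u (p + 0 *\<^sub>R 1) - \<phi> (r\<^sub>0 - 0) < u (p + (0 - h) *\<^sub>R 1) - \<phi> (r\<^sub>0 - (0 - h))"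
        by blast
      define h where "h = min e (1 - r\<^sub>0) / 2"
      have "0 < h" "h < e" "h < 1 - r\<^sub>0"
        using e(1) r0 by (auto simp: h_def)
      then show False
        using e(2)[of h] zero[of h] zero[of 0] r0 by simp
    qed
    ultimately have "l = 0"
      by simp
    moreover have flip: "(1 - 1 / (- ln r\<^sub>0)) / r\<^sub>0 = - ((1 / (- ln r\<^sub>0) - 1) / r\<^sub>0)"
      by (simp only: minus_divide_left minus_diff_eq)
    ultimately show ?thesis
      unfolding l_def flip by linarith
  qed

  ultimately have "(1 - 1 / (- ln r\<^sub>0)) / r\<^sub>0 \<le> c * (1 / (- ln (s + c)) - 1) / r\<^sub>0\<^sup>2"
    by (simp add: \<beta>_def)
  also have "\<dots> = c * (1 / (- ln (s + c)) - 1) / r\<^sub>0 / r\<^sub>0"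
    by (simp add: power2_eq_square)
  finally have "1 - 1 / (- ln r\<^sub>0) \<le> c * (1 / (- ln (s + c)) - 1) / r\<^sub>0"
    using r0(1) by (subst (asm) divide_le_cancel) auto
  then show False
    using slopes by (simp add: r\<^sub>0_def)
qed

section \<open>The choice of the circle\<close>

text \<open>The circle meets the real axis at \<open>- exp (- 1 - a)\<close> and \<open>exp (- 1 + 2 * a)\<close>.
  The product of the two distances to 0 is \<open>exp (- 2 + a)\<close>, which pushes the total curvature
  above \<open>2 * pi\<close>.  The prescribed inward derivative at the nearest
  point is of order \<open>a\<close>, while the affine bound has slope of order \<open>a\<^sup>2\<close>, since both the
  eccentricity and the derivative of the log-density are of order \<open>a\<close>.\<close>

lemma eccentric_circle_near_horocycle:
  fixes \<delta> :: real
  assumes "0 < \<delta>"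
  obtains c s :: real where "0 < c" "c < s" "s + c < 1"
    "exp (- 2) < s\<^sup>2 - c\<^sup>2" "exp (- 2) \<le> s - c" "s + c \<le> 3 * (s - c)"
    "- ln (s + c) \<le> 1" "c * (1 / (- ln (s + c)) - 1) / (s - c) < 1 - 1 / (- ln (s - c))"
    "s + c < 1 / exp 1 + \<delta>" "1 / exp 1 - \<delta> < s - c"
proof -
  (* The bound 1/10 makes the comparison of orders effective; \<delta>/4 keeps the circle
     in the annulus, since both of its distances to 0 differ from 1/e by at most 3a. *)
  define a where "a = min (1 / 10) (\<delta> / 4)"
  have a: "0 < a" "a \<le> 1 / 10" "a \<le> \<delta> / 4"
    using assms by (auto simp: a_def)
  define r\<^sub>0 r\<^sub>1 where "r\<^sub>0 = exp (- 1 - a)" and "r\<^sub>1 = exp (- 1 + 2 * a)"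
  define c s where "c = (r\<^sub>1 - r\<^sub>0) / 2" and "s = (r\<^sub>1 + r\<^sub>0) / 2"
  have sc: "s - c = r\<^sub>0" "s + c = r\<^sub>1"
    by (simp_all add: c_def s_def field_simps)
  have r: "0 < r\<^sub>0" "r\<^sub>0 < r\<^sub>1" "r\<^sub>1 < 1"
    using a by (auto simp: r\<^sub>0_def r\<^sub>1_def)
  have lns: "- ln r\<^sub>0 = 1 + a" "- ln r\<^sub>1 = 1 - 2 * a"
    by (simp_all add: r\<^sub>0_def r\<^sub>1_def)
  have ratio: "r\<^sub>1 = exp (3 * a) * r\<^sub>0"
    by (simp add: r\<^sub>0_def r\<^sub>1_def flip: exp_add)
  have "exp (3 * a) \<le> 1 + 3 * a + (3 * a)\<^sup>2"
    using a by (intro exp_bound) auto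
  also have "(3 * a)\<^sup>2 \<le> 3 * a * (3 / 10)"
    unfolding power2_eq_square using a by (intro mult_left_mono) auto
  finally have e3: "exp (3 * a) \<le> 14 / 10"
    using a by simp
  have c_le: "c / r\<^sub>0 \<le> 2 / 10"
    using r e3 by (simp add: c_def ratio field_simps)
  show thesis
  proof (rule that)
    show "0 < c" "c < s"
      using r by (auto simp: c_def s_def)
    show "s + c < 1" "- ln (s + c) \<le> 1"
      using r a by (simp_all add: sc lns)
    have "s\<^sup>2 - c\<^sup>2 = (s + c) * (s - c)"
      by (simp add: power2_eq_square algebra_simps)
    also have "\<dots> = exp (- 2 + a)"
      unfolding sc by (simp add: r\<^sub>0_def r\<^sub>1_def flip: exp_add)
    finally show "exp (- 2) < s\<^sup>2 - c\<^sup>2"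
      using a by simp
    show "exp (- 2) \<le> s - c"
      using a by (simp add: sc r\<^sub>0_def)
    show "s + c \<le> 3 * (s - c)"
      unfolding sc ratio using e3 r(1) by (intro mult_right_mono) auto
    show "c * (1 / (- ln (s + c)) - 1) / (s - c) < 1 - 1 / (- ln (s - c))"
    proof -
      have "c * (1 / (- ln (s + c)) - 1) / (s - c) = c / r\<^sub>0 * (2 * a / (1 - 2 * a))"
        using a unfolding sc lns by (simp add: field_simps)
      also have "\<dots> \<le> 2 / 10 * (2 * a / (8 / 10))"
        using a r \<open>0 < c\<close> by (intro mult_mono c_le frac_le) auto
      also have "\<dots> < a / (1 + a)"
        using a by (simp add: field_simps)
      also have "\<dots> = 1 - 1 / (- ln (s - c))"
        using a unfolding sc lns by (simp add: field_simps)
      finally show ?thesis .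
    qed
    have e1: "exp (- 1 :: real) \<le> 1" "1 / exp (1 :: real) = exp (- 1)"
      by (simp_all add: exp_minus inverse_eq_divide)
    have "exp (2 * a) \<le> 1 + 2 * a + (2 * a)\<^sup>2"
      using a by (intro exp_bound) auto
    also have "(2 * a)\<^sup>2 \<le> 2 * a * (2 / 10)"
      unfolding power2_eq_square using a by (intro mult_left_mono) auto
    finally have "exp (2 * a) - 1 < \<delta>"
      using a by simp
    then have "exp (- 1) * (exp (2 * a) - 1) < 1 * \<delta>"
      using e1(1) a assms by (intro mult_le_less_imp_less) auto
    moreover have "r\<^sub>1 = exp (- 1) * exp (2 * a)"
      by (simp add: r\<^sub>1_def flip: exp_add)
    ultimately show "s + c < 1 / exp 1 + \<delta>"
      unfolding sc e1(2) by (simp add: algebra_simps)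
    have "1 - exp (- a) < \<delta>"
      using exp_ge_add_one_self[of "- a"] a assms by linarith
    then have "exp (- 1) * (1 - exp (- a)) < 1 * \<delta>"
      using e1(1) a assms by (intro mult_le_less_imp_less) auto
    moreover have "r\<^sub>0 = exp (- 1) * exp (- a)"
      by (simp add: r\<^sub>0_def flip: exp_add)
    ultimately show "1 / exp 1 - \<delta> < s - c"
      unfolding sc e1(2) by (simp add: algebra_simps)
  qed
qed

theorem theorem9:
  shows "(\<exists>\<gamma>. smooth_simple_closed_curve \<gamma> \<and> path_image \<gamma> \<subseteq> punctured_disk \<and>
            (\<forall>r\<in>{0<..<1}. homologous_loops punctured_disk \<gamma> (circlepath 0 r)) \<and>
            convex_curve hyp_density \<gamma> \<and>
            total_geodesic_curvature hyp_density \<gamma> > 2 * pi \<and>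
            (\<nexists>u. negatively_curved_completion \<gamma> u)) \<and>
         (\<forall>\<delta>>0. \<exists>\<gamma>. smooth_simple_closed_curve \<gamma> \<and> path_image \<gamma> \<subseteq> punctured_disk \<and>
            (\<forall>r\<in>{0<..<1}. homologous_loops punctured_disk \<gamma> (circlepath 0 r)) \<and>
            convex_curve hyp_density \<gamma> \<and>
            total_geodesic_curvature hyp_density \<gamma> > 2 * pi \<and>
            (\<nexists>u. negatively_curved_completion \<gamma> u) \<and>
            path_image \<gamma> \<subseteq> {z. \<bar>norm z - 1 / exp 1\<bar> < \<delta>})"
    (is "(\<exists>\<gamma>. ?A \<gamma> \<and> ?B \<gamma> \<and> ?C \<gamma> \<and> ?D \<gamma> \<and> ?E \<gamma> \<and> ?F \<gamma>) \<and> (\<forall>\<delta>>0. \<exists>\<gamma>. ?G \<delta> \<gamma>)")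
proof -
  have near: "\<forall>\<delta>>0. \<exists>\<gamma>. ?G \<delta> \<gamma>"
  proof (intro allI impI)
    fix \<delta> :: real assume "0 < \<delta>"
    then obtain c s :: real where cs: "0 < c" "c < s" "s + c < 1"
      "exp (- 2) < s\<^sup>2 - c\<^sup>2" "exp (- 2) \<le> s - c" "s + c \<le> 3 * (s - c)"
      "- ln (s + c) \<le> 1" "c * (1 / (- ln (s + c)) - 1) / (s - c) < 1 - 1 / (- ln (s - c))"
      "s + c < 1 / exp 1 + \<delta>" "1 / exp 1 - \<delta> < s - c"
      using eccentric_circle_near_horocycle by metis
    define \<gamma> where "\<gamma> = circlepath (of_real c) s"
    have n: "norm (complex_of_real c) = c"
      using cs by simp
    have annulus: "s - c \<le> norm z" "norm z \<le> s + c" if "z \<in> path_image \<gamma>" for z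
      using that circlepath_bounds[of s "of_real c"] cs by (auto simp: path_image_def \<gamma>_def)
    show "\<exists>\<gamma>. ?G \<delta> \<gamma>"
    proof (intro exI[of _ \<gamma>] conjI ballI)
      show "smooth_simple_closed_curve \<gamma>"
        unfolding \<gamma>_def using cs by (intro smooth_simple_closed_curve_circlepath) simp
      show "path_image \<gamma> \<subseteq> punctured_disk"
        using annulus cs unfolding punctured_disk_def by fastforce
      show "homologous_loops punctured_disk \<gamma> (circlepath 0 r)" if "r \<in> {0<..<1}" for r
        unfolding \<gamma>_def using that cs by (intro homologous_loops_punctured_disk) (auto simp: n)
      show "convex_curve hyp_density \<gamma>"
        unfolding \<gamma>_def using cs by (intro convex_curve_circlepath) (simp_all only: n)
      show "2 * pi < total_geodesic_curvature hyp_density \<gamma>"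
        unfolding \<gamma>_def using cs by (intro total_geodesic_curvature_circlepath_gt) (simp_all only: n)
      show "\<nexists>u. negatively_curved_completion \<gamma> u"
        unfolding \<gamma>_def using no_negatively_curved_completion_circlepath[OF cs(1-3,7,8)] by blast
      show "path_image \<gamma> \<subseteq> {z. \<bar>norm z - 1 / exp 1\<bar> < \<delta>}"
        using annulus cs by fastforce
    qed
  qed
  then have "\<exists>\<gamma>. ?G 1 \<gamma>"
    by (simp only: zero_less_one)
  with near show ?thesis
    by blast
qed

end
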